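(* Let $M$ be a Kähler manifold and let $\omega$ be a holomorphic $p$-form on $M$, i.e. a smooth form $\omega$ of type $(p,0)$ with $\bar\partial\omega=0$. Then at every point where $\omega\ne 0$, \[ \bigl|d|\omega|\bigr|\le \frac{1}{\sqrt2}\,|\nabla\omega| . \]
   Context: The bundle of $(p,0)$-forms carries the Hermitian metric induced by the Kähler metric; $|\cdot|$ denotes the pointwise norms induced by this metric on forms, on (real) 1-forms, and on $T^*_{\mathbb C}M\otimes\Lambda^{p,0}T^*M$. $\nabla$ is the Levi-Civita connection extended complex-linearly to forms. *)

theory Defs
  imports "HOL-Analysis.Analysis"
begin

primrec diff_upto :: "nat \<Rightarrow> 'a::real_normed_vector set \<Rightarrow> ('a \<Rightarrow> 'b::real_normed_vector) \<Rightarrow> bool" where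
  "diff_upto 0 S f \<longleftrightarrow> continuous_on S f"
| "diff_upto (Suc k) S f \<longleftrightarrow> (\<forall>x\<in>S. f differentiable (at x)) \<and>
     (\<forall>v. diff_upto k S (\<lambda>x. frechet_derivative f (at x) v))"

text \<open>The set \<^term>\<open>S\<close> is meant to be open.\<close>

definition smooth_on :: "'a::real_normed_vector set \<Rightarrow> ('a \<Rightarrow> 'b::real_normed_vector) \<Rightarrow> bool" where
  "smooth_on S f \<longleftrightarrow> (\<forall>k. diff_upto k S f)"

definition holomorphic_map_on :: "(complex^'n) set \<Rightarrow> (complex^'n \<Rightarrow> complex^'m) \<Rightarrow> bool" where
  "holomorphic_map_on S f \<longleftrightarrow>
     (\<forall>x\<in>S. \<exists>L. (f has_derivative L) (at x) \<and> (\<forall>c v. L (c *s v) = c *s L v))"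

type_synonym ('a, 'n) chart = "'a set \<times> ('a \<Rightarrow> complex^'n)"

abbreviation cdom :: "('a, 'n::finite) chart \<Rightarrow> 'a set" where "cdom c \<equiv> fst c"
abbreviation cmap :: "('a, 'n::finite) chart \<Rightarrow> 'a \<Rightarrow> complex^'n" where "cmap c \<equiv> snd c"
abbreviation cimg :: "('a, 'n::finite) chart \<Rightarrow> (complex^'n) set" where "cimg c \<equiv> cmap c ` cdom c"

definition transition :: "('a, 'n::finite) chart \<Rightarrow> ('a, 'n) chart \<Rightarrow> complex^'n \<Rightarrow> complex^'n" where
  "transition c c' = cmap c' \<circ> inv_into (cdom c) (cmap c)"

locale complex_manifold =
  fixes M :: "'a topology" and \<A> :: "('a, 'n::finite) chart set"
  assumes hausdorff: "Hausdorff_space M"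
    and second_countable: "second_countable M"
    and chart_open: "c \<in> \<A> \<Longrightarrow> openin M (cdom c) \<and> open (cimg c)"
    and chart_homeo: "c \<in> \<A> \<Longrightarrow>
          homeomorphic_map (subtopology M (cdom c)) (top_of_set (cimg c)) (cmap c)"
    and charts_cover: "(\<Union>c\<in>\<A>. cdom c) = topspace M"
    and transition_holomorphic: "c \<in> \<A> \<Longrightarrow> c' \<in> \<A> \<Longrightarrow>
          holomorphic_map_on (cmap c ` (cdom c \<inter> cdom c')) (transition c c')"

text \<open>
  Tensor fields are given by their components in every chart \<^term>\<open>c\<close>, as functions on
  \<^term>\<open>cimg c\<close>, subject to the usual transformation law. The real tangent space is identified
  with \<open>complex^'n\<close> by the chart; the complex structure \<open>J\<close> is then multiplication by \<open>\<i>\<close>.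
  A complex-valued \<open>p\<close>-form takes the list of its \<open>p\<close> real tangent vector arguments; lists of other
  lengths are irrelevant.
\<close>

type_synonym 'n metric = "complex^'n \<Rightarrow> complex^'n \<Rightarrow> real"
type_synonym 'n cform = "(complex^'n) list \<Rightarrow> complex"

definition metric_tensor_on ::
  "('a, 'n::finite) chart set \<Rightarrow> (('a, 'n) chart \<Rightarrow> complex^'n \<Rightarrow> 'n metric) \<Rightarrow> bool" where
  "metric_tensor_on \<A> g \<longleftrightarrow>
     (\<forall>c\<in>\<A>. \<forall>x\<in>cimg c. bilinear (g c x) \<and> (\<forall>u v. g c x u v = g c x v u)
                        \<and> (\<forall>v. v \<noteq> 0 \<longrightarrow> g c x v v > 0)) \<and>
     (\<forall>c\<in>\<A>. \<forall>u v. smooth_on (cimg c) (\<lambda>x. g c x u v)) \<and>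
     (\<forall>c\<in>\<A>. \<forall>c'\<in>\<A>. \<forall>x\<in>cmap c ` (cdom c \<inter> cdom c'). \<forall>u v.
        g c x u v = g c' (transition c c' x) (frechet_derivative (transition c c') (at x) u)
                                             (frechet_derivative (transition c c') (at x) v))"

definition alternating_form :: "nat \<Rightarrow> 'n::finite cform \<Rightarrow> bool" where
  "alternating_form p \<alpha> \<longleftrightarrow>
     (\<forall>vs. length vs = p \<longrightarrow> (\<forall>i<p. linear (\<lambda>v. \<alpha> (vs[i := v])))) \<and>
     (\<forall>vs. length vs = p \<longrightarrow> (\<exists>i j. i < j \<and> j < p \<and> vs ! i = vs ! j) \<longrightarrow> \<alpha> vs = 0)"

definition smooth_form_on ::
  "('a, 'n::finite) chart set \<Rightarrow> nat \<Rightarrow> (('a, 'n) chart \<Rightarrow> complex^'n \<Rightarrow> 'n cform) \<Rightarrow> bool" where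
  "smooth_form_on \<A> p \<omega> \<longleftrightarrow>
     (\<forall>c\<in>\<A>. \<forall>x\<in>cimg c. alternating_form p (\<omega> c x)) \<and>
     (\<forall>c\<in>\<A>. \<forall>vs. length vs = p \<longrightarrow> smooth_on (cimg c) (\<lambda>x. \<omega> c x vs)) \<and>
     (\<forall>c\<in>\<A>. \<forall>c'\<in>\<A>. \<forall>x\<in>cmap c ` (cdom c \<inter> cdom c'). \<forall>vs. length vs = p \<longrightarrow>
        \<omega> c x vs = \<omega> c' (transition c c' x) (map (frechet_derivative (transition c c') (at x)) vs))"

definition del_nth :: "nat \<Rightarrow> 'b list \<Rightarrow> 'b list" where
  "del_nth i vs = take i vs @ drop (Suc i) vs"

text \<open>The arguments are constant vector fields of the chart, so no bracket terms occur.\<close>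

definition ext_deriv ::
  "('v::real_normed_vector \<Rightarrow> 'v list \<Rightarrow> 'b::real_normed_vector) \<Rightarrow> 'v \<Rightarrow> 'v list \<Rightarrow> 'b" where
  "ext_deriv \<alpha> x vs = (\<Sum>i<length vs.
     (-1) ^ i *\<^sub>R frechet_derivative (\<lambda>y. \<alpha> y (del_nth i vs)) (at x) (vs ! i))"

definition fundamental_form :: "'n::finite metric \<Rightarrow> (complex^'n) list \<Rightarrow> real" where
  "fundamental_form h vs = h (\<i> *s (vs ! 0)) (vs ! 1)"

locale kaehler_manifold = complex_manifold M \<A>
  for M :: "'a topology" and \<A> :: "('a, 'n::finite) chart set" +
  fixes g :: "('a, 'n) chart \<Rightarrow> complex^'n \<Rightarrow> 'n metric"
  assumes metric_tensor: "metric_tensor_on \<A> g"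
    and metric_hermitian: "c \<in> \<A> \<Longrightarrow> x \<in> cimg c \<Longrightarrow> g c x (\<i> *s u) (\<i> *s v) = g c x u v"
    and fundamental_form_closed: "c \<in> \<A> \<Longrightarrow> x \<in> cimg c \<Longrightarrow> length vs = 3 \<Longrightarrow>
          ext_deriv (\<lambda>y. fundamental_form (g c y)) x vs = 0"

text \<open>
  A \<open>p\<close>-form is of type \<open>(p,0)\<close> if its complex multilinear extension vanishes as soon as one argument
  is a vector \<open>v + \<i> J v\<close> of type \<open>(0,1)\<close>.
\<close>

definition type_p0 :: "nat \<Rightarrow> 'n::finite cform \<Rightarrow> bool" where
  "type_p0 p \<alpha> \<longleftrightarrow> (\<forall>vs v. \<forall>i<p. length vs = p \<longrightarrow>
     \<alpha> (vs[i := v]) + \<i> * \<alpha> (vs[i := \<i> *s v]) = 0)"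

text \<open>The component \<open>\<partial>bar f\<close> of type \<open>(0,1)\<close> of \<open>df\<close>, for a complex-valued function \<open>f\<close>.\<close>

definition dbar_fun :: "(complex^'n::finite \<Rightarrow> complex) \<Rightarrow> complex^'n \<Rightarrow> complex^'n \<Rightarrow> complex" where
  "dbar_fun f x v =
     (frechet_derivative f (at x) v + \<i> * frechet_derivative f (at x) (\<i> *s v)) / 2"

text \<open>
  If \<open>\<omega> = \<Sum> f\<^sub>I dz\<^sub>I\<close>, then \<open>\<partial>bar \<omega> = \<Sum> \<partial>bar f\<^sub>I \<and> dz\<^sub>I\<close>. As \<open>dz\<^sub>I\<close> is constant in the
  chart, this is the exterior derivative with \<open>d\<close> replaced by \<open>\<partial>bar\<close> on components; only for forms
  of type \<open>(p,0)\<close>.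
\<close>

definition dbar :: "(complex^'n \<Rightarrow> 'n::finite cform) \<Rightarrow> complex^'n \<Rightarrow> 'n cform" where
  "dbar \<omega> x vs = (\<Sum>i<length vs. (-1) ^ i * dbar_fun (\<lambda>y. \<omega> y (del_nth i vs)) x (vs ! i))"

definition holomorphic_form_on ::
  "('a, 'n::finite) chart set \<Rightarrow> nat \<Rightarrow> (('a, 'n) chart \<Rightarrow> complex^'n \<Rightarrow> 'n cform) \<Rightarrow> bool" where
  "holomorphic_form_on \<A> p \<omega> \<longleftrightarrow> smooth_form_on \<A> p \<omega> \<and>
     (\<forall>c\<in>\<A>. \<forall>x\<in>cimg c. type_p0 p (\<omega> c x) \<and>
        (\<forall>vs. length vs = Suc p \<longrightarrow> dbar (\<omega> c) x vs = 0))"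

text \<open>
  \<open>christoffel h x u v\<close> is \<open>\<nabla>\<^sub>u v\<close> at \<open>x\<close> for constant vector fields \<open>u\<close>, \<open>v\<close> of the chart; the
  conditions say that \<open>\<nabla>\<close> is torsion-free and metric, which determines it uniquely.
\<close>

definition christoffel ::
  "(complex^'n::finite \<Rightarrow> 'n metric) \<Rightarrow> complex^'n \<Rightarrow> complex^'n \<Rightarrow> complex^'n \<Rightarrow> complex^'n" where
  "christoffel h x = (THE \<Gamma>. bilinear \<Gamma> \<and> (\<forall>u v. \<Gamma> u v = \<Gamma> v u) \<and>
     (\<forall>u v w. frechet_derivative (\<lambda>y. h y u v) (at x) w = h x (\<Gamma> w u) v + h x u (\<Gamma> w v)))"

definition cov_deriv ::
  "(complex^'n::finite \<Rightarrow> 'n metric) \<Rightarrow> (complex^'n \<Rightarrow> 'n cform) \<Rightarrow> complex^'n \<Rightarrow> complex^'n \<Rightarrow> 'n cform"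
  where
  "cov_deriv h \<omega> x u vs = frechet_derivative (\<lambda>y. \<omega> y vs) (at x) u
     - (\<Sum>i<length vs. \<omega> x (vs[i := christoffel h x u (vs ! i)]))"

definition orthonormal_basis :: "'n::finite metric \<Rightarrow> (complex^'n) set \<Rightarrow> bool" where
  "orthonormal_basis h E \<longleftrightarrow> finite E \<and> span E = UNIV \<and>
     (\<forall>u\<in>E. \<forall>v\<in>E. h u v = (if u = v then 1 else 0))"

text \<open>
  A real orthonormal basis; the norms below do not depend on its choice. They are normalised so that
  the wedge products of the dual basis \<open>1\<close>-forms are orthonormal.
\<close>

definition onb :: "'n::finite metric \<Rightarrow> (complex^'n) set" where
  "onb h = (SOME E. orthonormal_basis h E)"

definition form_norm :: "'n::finite metric \<Rightarrow> nat \<Rightarrow> 'n cform \<Rightarrow> real" where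
  "form_norm h p \<alpha> =
     sqrt ((\<Sum>vs | set vs \<subseteq> onb h \<and> length vs = p. (cmod (\<alpha> vs))\<^sup>2) / fact p)"

definition covector_norm :: "'n::finite metric \<Rightarrow> (complex^'n \<Rightarrow> real) \<Rightarrow> real" where
  "covector_norm h l = sqrt (\<Sum>e\<in>onb h. (l e)\<^sup>2)"

text \<open>The norm on the tensor product of the complexified cotangent space with the \<open>p\<close>-forms.\<close>

definition form_valued_norm :: "'n::finite metric \<Rightarrow> nat \<Rightarrow> (complex^'n \<Rightarrow> 'n cform) \<Rightarrow> real" where
  "form_valued_norm h p T = sqrt (\<Sum>e\<in>onb h. (form_norm h p (T e))\<^sup>2)"

end

theory Submission
  imports Defs
begin

text \<open>
  Write \<open>J\<close> for multiplication by \<open>\<i>\<close> on tangent vectors. Two facts make the improved constant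
  possible. A Kaehler metric has \<open>\<nabla>J = 0\<close>, and the components of a holomorphic form in a holomorphic
  chart satisfy the Cauchy-Riemann equations; together, for a form \<open>\<omega>\<close> of type \<open>(p,0)\<close>, they give
  \<open>\<nabla>\<^bsub>Jw\<^esub> \<omega> = \<i> \<nabla>\<^bsub>w\<^esub> \<omega>\<close> (\<open>cov_deriv_ii\<close>). As \<open>\<nabla>\<close> is metric, the differential \<open>l\<close> of \<open>\<bar>\<omega>\<bar>\<close> is
  \<open>l w = Re \<langle>\<nabla>\<^bsub>w\<^esub> \<omega>, \<omega>\<rangle> / \<bar>\<omega>\<bar>\<close>. Hence \<open>l w\<close> and \<open>- l (J w)\<close> are the real and imaginary parts of one
  complex number, and Cauchy-Schwarz bounds both at once:
  \<open>(l w)\<^sup>2 + (l (J w))\<^sup>2 \<le> \<bar>\<nabla>\<^bsub>w\<^esub> \<omega>\<bar>\<^sup>2\<close>. Let \<open>w\<close> run through an orthonormal basis \<open>E\<close>. Since \<open>J ` E\<close> is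
  orthonormal too, each of the two squares on the left sums to \<open>\<bar>l\<bar>\<^sup>2\<close>, so that
  \<open>2 \<bar>l\<bar>\<^sup>2 \<le> \<bar>\<nabla>\<omega>\<bar>\<^sup>2\<close>.

  The analytic part is the formula for \<open>l\<close> (\<open>has_derivative_sum_norm_sq\<close>): the norm at a point uses an
  orthonormal basis chosen at that point, with no continuity from one point to the next. The
  comparison lemma \<open>form_norm_mono\<close> shows that the norm of a form depends only on the metric, and
  monotonically. So a frame whose Gram matrix is the identity up to \<open>o(\<bar>y - x\<bar>)\<close> computes the norm to first
  order, and one such frame, parallel to first order at \<open>x\<close>, is explicit in the Christoffel symbols.
\<close>

section \<open>Multilinear maps and the product rule\<close>

lemma linear_combination:
  "linear f \<Longrightarrow> f (\<Sum>i\<in>I. c i *\<^sub>R v i) = (\<Sum>i\<in>I. c i *\<^sub>R f (v i))"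
  by (simp add: linear_sum linear_scale)

definition multilinear :: "nat \<Rightarrow> ('a::real_vector list \<Rightarrow> 'b::real_vector) \<Rightarrow> bool" where
  "multilinear p \<alpha> \<longleftrightarrow>
     (\<forall>vs i. length vs = p \<longrightarrow> i < p \<longrightarrow> linear (\<lambda>v. \<alpha> (vs[i := v])))"

lemma alternating_form_imp_multilinear: "alternating_form p \<alpha> \<Longrightarrow> multilinear p \<alpha>"
  by (simp add: alternating_form_def multilinear_def)

lemma multilinear_tail:
  assumes "multilinear (Suc p) \<alpha>"
  shows "multilinear p (\<lambda>vs. \<alpha> (v # vs))"
  unfolding multilinear_def
proof (intro allI impI)
  fix vs :: "'a list" and i
  assume "length vs = p" "i < p"
  with assms have "linear (\<lambda>w. \<alpha> ((v # vs)[Suc i := w]))"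
    unfolding multilinear_def by (metis Suc_less_eq length_Cons)
  then show "linear (\<lambda>w. \<alpha> (v # vs[i := w]))" by simp
qed

lemma multilinear_head:
  assumes "multilinear (Suc p) \<alpha>" "length vs = p"
  shows "linear (\<lambda>v. \<alpha> (v # vs))"
proof -
  have "linear (\<lambda>w. \<alpha> ((undefined # vs)[0 := w]))"
    using assms unfolding multilinear_def by (metis length_Cons zero_less_Suc)
  then show ?thesis by simp
qed

lemma multilinear_pair:
  assumes "bilinear h"
  shows "multilinear 2 (\<lambda>vs. h (vs ! 0) (vs ! 1))"
proof -
  have "linear (\<lambda>v. h (vs[i := v] ! 0) (vs[i := v] ! 1))"
    if "length vs = 2" "i < 2" for vs :: "'a list" and i
  proof -
    from that(2) consider "i = 0" | "i = 1" by linarith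
    then show ?thesis
      using assms that(1) by cases (auto simp: bilinear_def)
  qed
  then show ?thesis by (simp add: multilinear_def)
qed

lemma multilinear_eq_0:
  assumes "multilinear p \<alpha>" "span E = UNIV"
    and "\<And>vs. set vs \<subseteq> E \<Longrightarrow> length vs = p \<Longrightarrow> \<alpha> vs = 0"
    and "length vs = p"
  shows "\<alpha> vs = 0"
  using assms
proof (induction p arbitrary: \<alpha> vs)
  case 0
  then show ?case by simp
next
  case (Suc p)
  from Suc.prems(4) obtain v ws where vs: "vs = v # ws" "length ws = p"
    by (metis length_Suc_conv)
  have "\<alpha> (e # ws) = 0" if "e \<in> E" for e
  proof (rule Suc.IH[of "\<lambda>us. \<alpha> (e # us)"])
    show "multilinear p (\<lambda>us. \<alpha> (e # us))" by (rule multilinear_tail[OF Suc.prems(1)])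
    show "\<alpha> (e # us) = 0" if "set us \<subseteq> E" "length us = p" for us
      using Suc.prems(3)[of "e # us"] that \<open>e \<in> E\<close> by simp
  qed (use Suc.prems vs in auto)
  moreover have "linear (\<lambda>v. \<alpha> (v # ws))"
    using multilinear_head[OF Suc.prems(1) vs(2)] .
  ultimately show ?case
    using linear_eq_on[of "\<lambda>v. \<alpha> (v # ws)" "\<lambda>_. 0" v E] Suc.prems(2) vs(1)
    by (simp add: linear_iff)
qed

lemma frechet_derivative_sum_scaleR:
  fixes f :: "'i \<Rightarrow> 'a::real_normed_vector \<Rightarrow> 'b::real_normed_vector"
  assumes "\<And>i. i \<in> I \<Longrightarrow> f i differentiable (at x)"
  shows "frechet_derivative (\<lambda>y. \<Sum>i\<in>I. c i *\<^sub>R f i y) (at x) w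
    = (\<Sum>i\<in>I. c i *\<^sub>R frechet_derivative (f i) (at x) w)"
proof -
  have "((\<lambda>y. \<Sum>i\<in>I. c i *\<^sub>R f i y) has_derivative
      (\<lambda>w. \<Sum>i\<in>I. c i *\<^sub>R frechet_derivative (f i) (at x) w)) (at x)"
    by (intro has_derivative_sum has_derivative_scaleR_right)
      (use assms frechet_derivative_works in blast)
  then show ?thesis by (simp add: frechet_derivative_at[symmetric])
qed

lemma frechet_derivative_cong_open:
  assumes "open S" "x \<in> S" "\<And>y. y \<in> S \<Longrightarrow> f y = g y"
  shows "frechet_derivative f (at x) = frechet_derivative g (at x)"
proof -
  have "(f has_derivative D) (at x) \<longleftrightarrow> (g has_derivative D) (at x)" for D
    using assms by (metis has_derivative_transform_within_open)
  then show ?thesis by (simp add: frechet_derivative_def)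
qed

lemma frechet_derivative_linear_parameter:
  fixes \<alpha> :: "'a::real_normed_vector \<Rightarrow> 'v::real_vector \<Rightarrow> 'b::real_normed_vector"
  assumes "open S" "x \<in> S" "\<And>y. y \<in> S \<Longrightarrow> linear (\<alpha> y)"
    and diff: "\<And>v. (\<lambda>y. \<alpha> y v) differentiable (at x)"
  shows "linear (\<lambda>v. frechet_derivative (\<lambda>y. \<alpha> y v) (at x) w)"
proof (rule linearI)
  have d: "((\<lambda>y. \<alpha> y v) has_derivative frechet_derivative (\<lambda>y. \<alpha> y v) (at x)) (at x)" for v
    using diff frechet_derivative_works by blast
  fix u v r
  have "frechet_derivative (\<lambda>y. \<alpha> y (u + v)) (at x) =
      frechet_derivative (\<lambda>y. \<alpha> y u + \<alpha> y v) (at x)"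
    using assms by (intro frechet_derivative_cong_open[of S]) (auto simp: linear_add)
  then show "frechet_derivative (\<lambda>y. \<alpha> y (u + v)) (at x) w =
      frechet_derivative (\<lambda>y. \<alpha> y u) (at x) w + frechet_derivative (\<lambda>y. \<alpha> y v) (at x) w"
    using frechet_derivative_at[OF has_derivative_add[OF d d]] by (metis (no_types, lifting))
  have "frechet_derivative (\<lambda>y. \<alpha> y (r *\<^sub>R u)) (at x) =
      frechet_derivative (\<lambda>y. r *\<^sub>R \<alpha> y u) (at x)"
    using assms by (intro frechet_derivative_cong_open[of S]) (auto simp: linear_scale)
  then show "frechet_derivative (\<lambda>y. \<alpha> y (r *\<^sub>R u)) (at x) w =
      r *\<^sub>R frechet_derivative (\<lambda>y. \<alpha> y u) (at x) w"
    using frechet_derivative_at[OF has_derivative_scaleR_right[OF d]] by (metis (no_types, lifting))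
qed

lemma has_derivative_zeroI:
  fixes f :: "'a::real_normed_vector \<Rightarrow> 'b::real_normed_vector"
  assumes "\<And>e. e > 0 \<Longrightarrow> \<forall>\<^sub>F y in nhds x. norm (f y - f x) \<le> e * norm (y - x)"
  shows "(f has_derivative (\<lambda>_. 0)) (at x)"
  unfolding has_derivative_at_alt
proof (intro conjI allI impI)
  fix e :: real assume "e > 0"
  from assms[OF this] show "\<exists>d>0. \<forall>y. norm (y - x) < d \<longrightarrow> norm (f y - f x - 0) \<le> e * norm (y - x)"
    by (simp add: eventually_nhds_metric dist_norm)
qed simp

text \<open>The product rule; expanding the first argument in a basis reduces it to one argument fewer.\<close>

lemma has_derivative_multilinear:
  fixes \<alpha> :: "'a::real_normed_vector \<Rightarrow> 'v::euclidean_space list \<Rightarrow> 'b::real_normed_vector"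
  assumes "open S" "x \<in> S" "\<And>y. y \<in> S \<Longrightarrow> multilinear p (\<alpha> y)"
    and "\<And>vs. length vs = p \<Longrightarrow> (\<lambda>y. \<alpha> y vs) differentiable (at x)"
    and F: "\<And>u. ((\<lambda>y. F y u) has_derivative (\<lambda>w. F' w u)) (at x)"
    and "length us = p"
  shows "((\<lambda>y. \<alpha> y (map (F y) us)) has_derivative
      (\<lambda>w. frechet_derivative (\<lambda>y. \<alpha> y (map (F x) us)) (at x) w
         + (\<Sum>i<p. \<alpha> x ((map (F x) us)[i := F' w (us ! i)])))) (at x)"
  using assms(3,4,6)
proof (induction p arbitrary: \<alpha> us)
  case 0
  then show ?case by (simp add: frechet_derivative_works[symmetric])
next
  case (Suc p)
  then obtain u vs where us: "us = u # vs" "length vs = p"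
    by (metis length_Suc_conv)
  let ?vs = "map (F x) vs"
  note lin = multilinear_head[OF Suc.prems(1)]
  have expand: "\<alpha> y (v # ws) = (\<Sum>b\<in>Basis. (v \<bullet> b) *\<^sub>R \<alpha> y (b # ws))"
    if "y \<in> S" "length ws = p" for y v ws
  proof -
    have "\<alpha> y (v # ws) = \<alpha> y ((\<Sum>b\<in>Basis. (v \<bullet> b) *\<^sub>R b) # ws)"
      by (simp add: euclidean_representation)
    also have "\<dots> = (\<Sum>b\<in>Basis. (v \<bullet> b) *\<^sub>R \<alpha> y (b # ws))"
      by (rule linear_combination[OF lin[OF that]])
    finally show ?thesis .
  qed
  define D where "D b w = frechet_derivative (\<lambda>y. \<alpha> y (b # ?vs)) (at x) w
      + (\<Sum>i<p. \<alpha> x (b # ?vs[i := F' w (vs ! i)]))" for b w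
  have IH: "((\<lambda>y. \<alpha> y (b # map (F y) vs)) has_derivative D b) (at x)" for b
    unfolding D_def using Suc.IH[of "\<lambda>y ws. \<alpha> y (b # ws)" vs] Suc.prems us
    by (simp add: multilinear_tail)
  have deriv: "((\<lambda>y. \<Sum>b\<in>Basis. (F y u \<bullet> b) *\<^sub>R \<alpha> y (b # map (F y) vs)) has_derivative
      (\<lambda>w. \<Sum>b\<in>Basis. (F x u \<bullet> b) *\<^sub>R D b w + (F' w u \<bullet> b) *\<^sub>R \<alpha> x (b # ?vs))) (at x)"
    by (intro has_derivative_sum has_derivative_scaleR IH has_derivative_inner_left F)
  have "(\<Sum>b\<in>Basis. (F x u \<bullet> b) *\<^sub>R D b w + (F' w u \<bullet> b) *\<^sub>R \<alpha> x (b # ?vs))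
    = frechet_derivative (\<lambda>y. \<alpha> y (map (F x) us)) (at x) w
         + (\<Sum>i<Suc p. \<alpha> x ((map (F x) us)[i := F' w (us ! i)]))" for w
  proof -
    have "frechet_derivative (\<lambda>y. \<alpha> y (F x u # ?vs)) (at x) w =
        frechet_derivative (\<lambda>y. \<Sum>b\<in>Basis. (F x u \<bullet> b) *\<^sub>R \<alpha> y (b # ?vs)) (at x) w"
      using us assms(1,2) by (subst frechet_derivative_cong_open[of S]) (auto intro: expand)
    also have "\<dots> = (\<Sum>b\<in>Basis. (F x u \<bullet> b) *\<^sub>R frechet_derivative (\<lambda>y. \<alpha> y (b # ?vs)) (at x) w)"
      using Suc.prems(2) us by (intro frechet_derivative_sum_scaleR) auto
    finally have 1: "frechet_derivative (\<lambda>y. \<alpha> y (F x u # ?vs)) (at x) w = \<dots>" .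
    have 2: "(\<Sum>b\<in>Basis. (F' w u \<bullet> b) *\<^sub>R \<alpha> x (b # ?vs)) = \<alpha> x (F' w u # ?vs)"
      using expand[of x ?vs "F' w u"] assms(2) us by simp
    have 3: "\<alpha> x (F x u # ?vs[i := F' w (vs ! i)])
      = (\<Sum>b\<in>Basis. (F x u \<bullet> b) *\<^sub>R \<alpha> x (b # ?vs[i := F' w (vs ! i)]))" for i
      using assms(2) us by (intro expand) auto
    show ?thesis
      unfolding us(1) sum.lessThan_Suc_shift
      by (simp add: 1 2 3 D_def sum.distrib scaleR_add_right scaleR_sum_right
          sum.swap[of _ "{..<p}" Basis])
  qed
  then have "((\<lambda>y. \<Sum>b\<in>Basis. (F y u \<bullet> b) *\<^sub>R \<alpha> y (b # map (F y) vs)) has_derivative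
      (\<lambda>w. frechet_derivative (\<lambda>y. \<alpha> y (map (F x) us)) (at x) w
         + (\<Sum>i<Suc p. \<alpha> x ((map (F x) us)[i := F' w (us ! i)])))) (at x)"
    using deriv by simp
  then show ?case
    by (rule has_derivative_transform_within_open[OF _ assms(1,2)])
      (use us in \<open>auto intro: expand[symmetric]\<close>)
qed

section \<open>Orthonormal bases\<close>

definition positive_definite :: "('v::real_vector \<Rightarrow> 'v \<Rightarrow> real) \<Rightarrow> bool" where
  "positive_definite h \<longleftrightarrow> bilinear h \<and> (\<forall>u v. h u v = h v u) \<and> (\<forall>v. v \<noteq> 0 \<longrightarrow> h v v > 0)"

lemma positive_definite_eq_0:
  assumes "positive_definite h" "\<And>w. h v w = 0"
  shows "v = 0"
  using assms unfolding positive_definite_def by (metis less_irrefl)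

lemma ex_orthonormal_basis:
  fixes h :: "'n::finite metric"
  assumes "positive_definite h"
  shows "\<exists>E. orthonormal_basis h E"
proof -
  note h = assms[unfolded positive_definite_def]
  have ex: "\<exists>E. finite E \<and> span E = span B \<and> (\<forall>u\<in>E. \<forall>v\<in>E. h u v = (if u = v then 1 else 0))"
    if "finite B" for B
    using that
  proof (induction B rule: finite_induct)
    case empty
    show ?case by (intro exI[of _ "{}"]) simp
  next
    case (insert b B)
    then obtain E where E: "finite E" "span E = span B"
      and on: "\<And>u v. u \<in> E \<Longrightarrow> v \<in> E \<Longrightarrow> h u v = (if u = v then 1 else 0)"
      by blast
    have insert_b: "span (insert b E) = span (insert b B)"
      using E(2) by (simp add: span_insert)
    define r where "r = b - (\<Sum>e\<in>E. h b e *\<^sub>R e)"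
    have in_span: "b - r \<in> span E"
      unfolding r_def by (auto intro: span_sum span_scale span_base)
    have span_r: "span (insert b E) = span (insert r E)"
      using in_span by (rule eq_span_insert_eq)
    show ?case
    proof (cases "r = 0")
      case True
      then have "span E = span (insert b E)" using span_r span_insert_0 by metis
      then show ?thesis using E on insert_b by metis
    next
      case False
      define n where "n = r /\<^sub>R sqrt (h r r)"
      have pos: "h r r > 0" using h False by blast
      have lin: "linear (\<lambda>v. h v e)" for e using h by (simp add: bilinear_def)
      have "h r f = 0" if "f \<in> E" for f
      proof -
        have "h (\<Sum>e\<in>E. h b e *\<^sub>R e) f = (\<Sum>e\<in>E. h b e * h e f)"
          by (simp add: linear_combination[OF lin])
        also have "\<dots> = (\<Sum>e\<in>E. if e = f then h b e else 0)"
          using on that by (intro sum.cong) auto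
        also have "\<dots> = h b f" using that E by simp
        finally show ?thesis unfolding r_def using linear_diff[OF lin] by simp
      qed
      then have orth: "h n f = 0" if "f \<in> E" for f
        unfolding n_def using linear_scale[OF lin] that by simp
      have unit: "h n n = 1"
      proof -
        have "h n n = (h r r) / (sqrt (h r r) * sqrt (h r r))"
          unfolding n_def using h by (simp add: bilinear_lmul bilinear_rmul field_simps)
        then show ?thesis using pos by simp
      qed
      have "span (insert r E) = span (insert n E)"
      proof -
        have r: "r = sqrt (h r r) *\<^sub>R n" unfolding n_def using pos by simp
        have "r \<in> span (insert n E)"
          by (subst r) (intro span_scale span_base insertI1)
        moreover have "n \<in> span (insert r E)"
          unfolding n_def by (intro span_scale span_base insertI1)
        ultimately show ?thesis
          by (intro span_eq[THEN iffD2] conjI) (auto intro: span_base)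
      qed
      moreover have "\<forall>u\<in>insert n E. \<forall>v\<in>insert n E. h u v = (if u = v then 1 else 0)"
        using on orth unit h by (metis insert_iff)
      ultimately show ?thesis using E insert_b span_r by (metis finite_insert)
    qed
  qed
  show ?thesis
    using ex[OF finite_Basis] unfolding orthonormal_basis_def by (metis span_Basis)
qed

lemma orthonormal_basis_onb: "positive_definite h \<Longrightarrow> orthonormal_basis h (onb h)"
  unfolding onb_def using ex_orthonormal_basis by (rule someI_ex)

lemma orthonormal_basis_expansion:
  assumes "orthonormal_basis h E" "bilinear h"
  shows "v = (\<Sum>e\<in>E. h v e *\<^sub>R e)"
proof -
  have lin: "linear (\<lambda>v. h v e)" for e using assms by (simp add: bilinear_def)
  have "finite E" "v \<in> span E" using assms by (auto simp: orthonormal_basis_def)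
  then obtain c where c: "v = (\<Sum>e\<in>E. c e *\<^sub>R e)"
    by (auto simp: span_finite)
  have "h v f = c f" if "f \<in> E" for f
  proof -
    have "h v f = (\<Sum>e\<in>E. c e * h e f)"
      unfolding c by (simp add: linear_combination[OF lin])
    also have "\<dots> = (\<Sum>e\<in>E. if e = f then c e else 0)"
      using assms(1) that by (intro sum.cong) (auto simp: orthonormal_basis_def)
    also have "\<dots> = c f" using that \<open>finite E\<close> by simp
    finally show ?thesis .
  qed
  then show ?thesis using c by (metis (mono_tags, lifting) sum.cong)
qed

lemma orthonormal_basis_parseval:
  assumes "orthonormal_basis h E" "bilinear h"
  shows "h v v = (\<Sum>e\<in>E. (h v e)\<^sup>2)"
proof -
  have lin: "linear (h v)" using assms by (simp add: bilinear_def)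
  have "h v v = h v (\<Sum>e\<in>E. h v e *\<^sub>R e)"
    using orthonormal_basis_expansion[OF assms] by metis
  also have "\<dots> = (\<Sum>e\<in>E. (h v e)\<^sup>2)"
    by (simp add: linear_combination[OF lin] power2_eq_square)
  finally show ?thesis .
qed

section \<open>Comparison of form norms\<close>

text \<open>
  Enlarging a metric shrinks the dual norm. If \<open>b\<close> is the vector dual to \<open>\<beta>\<close> under \<open>h\<close>, then
  \<open>\<bar>\<beta>\<bar>\<^sup>2 = \<beta> b\<close>, and Cauchy-Schwarz for \<open>h'\<close> bounds \<open>\<beta> b\<close> by the \<open>h'\<close>-norms of \<open>\<beta>\<close> and \<open>b\<close>.
\<close>

lemma covector_norm_mono:
  fixes \<beta> :: "complex^'n::finite \<Rightarrow> real"
  assumes h: "orthonormal_basis h E" "bilinear h"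
    and h': "orthonormal_basis h' E'" "bilinear h'"
    and le: "\<And>v. h' v v \<le> K * h v v" "K \<ge> 0" and "linear \<beta>"
  shows "(\<Sum>e\<in>E. (\<beta> e)\<^sup>2) \<le> K * (\<Sum>e\<in>E'. (\<beta> e)\<^sup>2)"
proof -
  define b where "b = (\<Sum>e\<in>E. \<beta> e *\<^sub>R e)"
  let ?S = "\<Sum>e\<in>E. (\<beta> e)\<^sup>2" and ?S' = "\<Sum>e\<in>E'. (\<beta> e)\<^sup>2"
  note \<beta> = linear_combination[OF \<open>linear \<beta>\<close>]
  have "\<beta> b = ?S" unfolding b_def by (simp add: \<beta> power2_eq_square)
  have lin: "linear (\<lambda>v. h v e)" for e using h by (simp add: bilinear_def)
  have "h b f = \<beta> f" if "f \<in> E" for f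
  proof -
    have "h b f = (\<Sum>e\<in>E. \<beta> e * h e f)"
      unfolding b_def by (simp add: linear_combination[OF lin])
    also have "\<dots> = (\<Sum>e\<in>E. if e = f then \<beta> e else 0)"
      using h(1) that by (intro sum.cong) (auto simp: orthonormal_basis_def)
    also have "\<dots> = \<beta> f" using that h(1) by (simp add: orthonormal_basis_def)
    finally show ?thesis .
  qed
  then have "h b b = ?S" by (simp add: orthonormal_basis_parseval[OF h])
  have "?S = \<beta> (\<Sum>e\<in>E'. h' b e *\<^sub>R e)"
    using orthonormal_basis_expansion[OF h', of b] \<open>\<beta> b = ?S\<close> by simp
  also have "\<dots> = (\<Sum>e\<in>E'. h' b e * \<beta> e)" by (simp add: \<beta>)
  finally have "?S\<^sup>2 \<le> (\<Sum>e\<in>E'. (h' b e)\<^sup>2) * ?S'"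
    using Cauchy_Schwarz_ineq_sum[of "h' b" \<beta> E'] by simp
  also have "\<dots> = h' b b * ?S'" by (simp add: orthonormal_basis_parseval[OF h'])
  also have "\<dots> \<le> (K * ?S) * ?S'"
    using le(1)[of b] \<open>h b b = ?S\<close> by (intro mult_right_mono) (auto intro: sum_nonneg)
  finally have "?S * ?S \<le> ?S * (K * ?S')" by (simp add: power2_eq_square algebra_simps)
  moreover have "?S \<ge> 0" "K * ?S' \<ge> 0" using le(2) by (auto intro!: sum_nonneg mult_nonneg_nonneg)
  ultimately show ?thesis by (cases "?S = 0") auto
qed

abbreviation tuples :: "'a set \<Rightarrow> nat \<Rightarrow> 'a list set" where
  "tuples E p \<equiv> {vs. set vs \<subseteq> E \<and> length vs = p}"

lemma sum_tuples_Suc: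
  assumes "finite E"
  shows "(\<Sum>vs\<in>tuples E (Suc p). f vs) = (\<Sum>e\<in>E. \<Sum>vs\<in>tuples E p. f (e # vs))"
proof -
  have "(\<Sum>vs\<in>tuples E (Suc p). f vs) = (\<Sum>(e, vs)\<in>E \<times> tuples E p. f (e # vs))"
    by (rule sum.reindex_bij_witness[of _ "\<lambda>(e, vs). e # vs" "\<lambda>vs. (hd vs, tl vs)"])
      (auto simp: length_Suc_conv)
  then show ?thesis by (simp add: sum.cartesian_product)
qed

text \<open>The same for tensors, exchanging the basis in one argument after the other.\<close>

lemma form_norm_mono:
  fixes \<alpha> :: "'n::finite cform"
  assumes h: "orthonormal_basis h E" "bilinear h"
    and h': "orthonormal_basis h' E'" "bilinear h'"
    and le: "\<And>v. h' v v \<le> K * h v v" "K \<ge> 0" and "multilinear p \<alpha>"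
  shows "(\<Sum>vs\<in>tuples E p. (cmod (\<alpha> vs))\<^sup>2) \<le> K ^ p * (\<Sum>vs\<in>tuples E' p. (cmod (\<alpha> vs))\<^sup>2)"
  using \<open>multilinear p \<alpha>\<close>
proof (induction p arbitrary: \<alpha>)
  case 0
  have "tuples E 0 = {[]}" "tuples E' 0 = {[]}" by auto
  then show ?case by simp
next
  case (Suc p)
  have fin: "finite E" "finite E'" using h h' by (auto simp: orthonormal_basis_def)
  have head: "(\<Sum>e\<in>E. (cmod (\<alpha> (e # vs)))\<^sup>2) \<le> K * (\<Sum>e\<in>E'. (cmod (\<alpha> (e # vs)))\<^sup>2)"
    if "length vs = p" for vs
  proof -
    have lin: "linear (\<lambda>e. \<alpha> (e # vs))" using multilinear_head[OF Suc.prems that] .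
    have "linear (\<lambda>e. Re (\<alpha> (e # vs)))" "linear (\<lambda>e. Im (\<alpha> (e # vs)))"
      using linear_compose[OF lin, of Re] linear_compose[OF lin, of Im]
      by (auto simp: o_def bounded_linear_Re bounded_linear_Im bounded_linear.linear)
    then show ?thesis
      using covector_norm_mono[OF h h' le] by (simp add: cmod_power2 sum.distrib algebra_simps add_mono)
  qed
  have "(\<Sum>vs\<in>tuples E (Suc p). (cmod (\<alpha> vs))\<^sup>2)
      = (\<Sum>e\<in>E. \<Sum>vs\<in>tuples E p. (cmod (\<alpha> (e # vs)))\<^sup>2)"
    by (rule sum_tuples_Suc[OF fin(1)])
  also have "\<dots> \<le> (\<Sum>e\<in>E. K ^ p * (\<Sum>vs\<in>tuples E' p. (cmod (\<alpha> (e # vs)))\<^sup>2))"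
    by (intro sum_mono Suc.IH multilinear_tail Suc.prems)
  also have "\<dots> = K ^ p * (\<Sum>vs\<in>tuples E' p. \<Sum>e\<in>E. (cmod (\<alpha> (e # vs)))\<^sup>2)"
    by (simp add: sum_distrib_left[symmetric] sum.swap[of _ E])
  also have "\<dots> \<le> K ^ p * (\<Sum>vs\<in>tuples E' p. K * (\<Sum>e\<in>E'. (cmod (\<alpha> (e # vs)))\<^sup>2))"
    using le(2) by (intro mult_left_mono sum_mono head) auto
  also have "\<dots> = K ^ Suc p * (\<Sum>e\<in>E'. \<Sum>vs\<in>tuples E' p. (cmod (\<alpha> (e # vs)))\<^sup>2)"
    by (simp add: sum_distrib_left[symmetric] sum.swap[of _ E'])
  also have "\<dots> = K ^ Suc p * (\<Sum>vs\<in>tuples E' (Suc p). (cmod (\<alpha> vs))\<^sup>2)"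
    by (simp add: sum_tuples_Suc[OF fin(2)])
  finally show ?case .
qed

lemma multilinear_map:
  fixes L :: "'a::real_vector \<Rightarrow> 'b::real_vector"
  assumes "multilinear p \<alpha>" "linear L"
  shows "multilinear p (\<lambda>vs. \<alpha> (map L vs))"
  unfolding multilinear_def
proof (intro allI impI)
  fix vs :: "'a list" and i
  assume "length vs = p" "i < p"
  then have "linear (\<lambda>w. \<alpha> ((map L vs)[i := w]))"
    using assms(1) unfolding multilinear_def by simp
  from linear_compose[OF assms(2) this]
  show "linear (\<lambda>v. \<alpha> (map L (vs[i := v])))" by (simp add: map_update o_def)
qed

text \<open>
  A frame \<open>L ` E\<^sub>0\<close> whose Gram matrix is close to the identity computes the norm up to a small relative
  error: compare \<open>h\<^sub>0\<close> with the metric \<open>h\<close> pulled back by \<open>L\<close>.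
\<close>

lemma form_norm_almost_orthonormal:
  fixes \<alpha> :: "'n::finite cform" and h\<^sub>0 :: "'n metric"
  assumes h: "orthonormal_basis h E" "bilinear h"
    and h0: "orthonormal_basis h\<^sub>0 E\<^sub>0" "positive_definite h\<^sub>0"
    and "linear L" "multilinear p \<alpha>" and t: "0 \<le> t" "t < 1"
    and close: "\<And>v. \<bar>h (L v) (L v) - h\<^sub>0 v v\<bar> \<le> t * h\<^sub>0 v v"
  shows "(1 - t) ^ p * (\<Sum>vs\<in>tuples E p. (cmod (\<alpha> vs))\<^sup>2)
           \<le> (\<Sum>vs\<in>tuples E\<^sub>0 p. (cmod (\<alpha> (map L vs)))\<^sup>2)"
    and "(1 - t) ^ p * (\<Sum>vs\<in>tuples E\<^sub>0 p. (cmod (\<alpha> (map L vs)))\<^sup>2)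
           \<le> (\<Sum>vs\<in>tuples E p. (cmod (\<alpha> vs))\<^sup>2)"
proof -
  have lower: "(1 - t) * h\<^sub>0 v v \<le> h (L v) (L v)" for v
    using close[of v] by (simp add: algebra_simps)
  have upper: "h (L v) (L v) \<le> (1 + t) * h\<^sub>0 v v" for v
    using close[of v] by (simp add: algebra_simps)
  have pos: "h\<^sub>0 v v > 0" if "v \<noteq> 0" for v using h0(2) that by (simp add: positive_definite_def)
  have "v = 0" if "L v = 0" for v
    using lower[of v] pos[of v] that t bilinear_lzero[OF h(2)]
    by (metis diff_gt_0_iff_gt linorder_not_less mult_pos_pos)
  then have "inj L" using \<open>linear L\<close> by (simp add: linear_injective_0)
  then obtain L' where L': "linear L'" "\<And>v. L' (L v) = v" "\<And>v. L (L' v) = v"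
    using eucl.linear_injective_isomorphism[OF \<open>linear L\<close>] by blast
  define h' where "h' u v = h (L u) (L v)" for u v
  have h': "bilinear h'" "orthonormal_basis h' (L' ` E)"
  proof -
    show "bilinear h'"
      using h(2) linear_compose[OF \<open>linear L\<close>] unfolding bilinear_def h'_def o_def by blast
    have "v \<in> span (L' ` E)" for v
      using h(1) L' by (metis UNIV_I image_eqI linear_span_image orthonormal_basis_def)
    moreover have "L' u = L' v \<longleftrightarrow> u = v" for u v using L'(3) by metis
    ultimately show "orthonormal_basis h' (L' ` E)"
      using h(1) unfolding orthonormal_basis_def h'_def by (auto simp: L')
  qed
  have "(\<Sum>vs\<in>tuples (L' ` E) p. (cmod (\<alpha> (map L vs)))\<^sup>2)
      = (\<Sum>vs\<in>tuples E p. (cmod (\<alpha> (map L (map L' vs))))\<^sup>2)"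
  proof (rule sum.reindex_cong[of "map L'"])
    show "inj_on (map L') (tuples E p)"
      by (rule inj_on_inverseI[of _ "map L"]) (simp add: o_def L'(3))
    show "tuples (L' ` E) p = map L' ` tuples E p"
    proof (intro equalityI subsetI)
      fix vs assume vs: "vs \<in> tuples (L' ` E) p"
      then have "L ` set vs \<subseteq> L ` L' ` E" by (intro image_mono) simp
      then have "map L vs \<in> tuples E p" using vs by (simp add: image_image L'(3))
      moreover have "vs = map L' (map L vs)" by (simp add: o_def L'(2))
      ultimately show "vs \<in> map L' ` tuples E p" by (rule rev_image_eqI)
    qed (auto intro!: imageI)
  qed simp
  then have reindex: "(\<Sum>vs\<in>tuples E p. (cmod (\<alpha> vs))\<^sup>2)
      = (\<Sum>vs\<in>tuples (L' ` E) p. (cmod (\<alpha> (map L vs)))\<^sup>2)"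
    by (simp add: L' o_def)
  note multi = multilinear_map[OF \<open>multilinear p \<alpha>\<close> \<open>linear L\<close>]
  have bil0: "bilinear h\<^sub>0" using h0(2) by (simp add: positive_definite_def)
  have "(\<Sum>vs\<in>tuples E p. (cmod (\<alpha> vs))\<^sup>2)
      \<le> (1 / (1 - t)) ^ p * (\<Sum>vs\<in>tuples E\<^sub>0 p. (cmod (\<alpha> (map L vs)))\<^sup>2)"
    unfolding reindex using lower t
    by (intro form_norm_mono[OF h'(2,1) h0(1) bil0 _ _ multi])
      (auto simp: h'_def field_simps)
  then show "(1 - t) ^ p * (\<Sum>vs\<in>tuples E p. (cmod (\<alpha> vs))\<^sup>2)
      \<le> (\<Sum>vs\<in>tuples E\<^sub>0 p. (cmod (\<alpha> (map L vs)))\<^sup>2)"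
    using t by (simp add: field_simps)
  have "(\<Sum>vs\<in>tuples E\<^sub>0 p. (cmod (\<alpha> (map L vs)))\<^sup>2)
      \<le> (1 + t) ^ p * (\<Sum>vs\<in>tuples E p. (cmod (\<alpha> vs))\<^sup>2)"
    unfolding reindex using upper t
    by (intro form_norm_mono[OF h0(1) bil0 h'(2,1) _ _ multi]) (auto simp: h'_def)
  then have "(1 - t) ^ p * (\<Sum>vs\<in>tuples E\<^sub>0 p. (cmod (\<alpha> (map L vs)))\<^sup>2)
      \<le> (1 - t) ^ p * ((1 + t) ^ p * (\<Sum>vs\<in>tuples E p. (cmod (\<alpha> vs))\<^sup>2))"
    using t by (intro mult_left_mono) auto
  also have "\<dots> = (1 - t\<^sup>2) ^ p * (\<Sum>vs\<in>tuples E p. (cmod (\<alpha> vs))\<^sup>2)"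
    by (simp add: power_mult_distrib[symmetric] algebra_simps power2_eq_square)
  also have "\<dots> \<le> 1 * (\<Sum>vs\<in>tuples E p. (cmod (\<alpha> vs))\<^sup>2)"
    using t by (intro mult_right_mono power_le_one sum_nonneg) (auto simp: power_le_one)
  finally show "(1 - t) ^ p * (\<Sum>vs\<in>tuples E\<^sub>0 p. (cmod (\<alpha> (map L vs)))\<^sup>2)
      \<le> (\<Sum>vs\<in>tuples E p. (cmod (\<alpha> vs))\<^sup>2)" by simp
qed

section \<open>The Levi-Civita connection in a chart\<close>

locale chart_metric =
  fixes S :: "(complex^'n::finite) set" and h :: "complex^'n \<Rightarrow> 'n metric"
  assumes open_S: "open S"
    and pos_def: "x \<in> S \<Longrightarrow> positive_definite (h x)"
    and diff_metric: "x \<in> S \<Longrightarrow> (\<lambda>y. h y u v) differentiable (at x)"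
begin

definition Dh :: "complex^'n \<Rightarrow> complex^'n \<Rightarrow> complex^'n \<Rightarrow> complex^'n \<Rightarrow> real" where
  "Dh x w u v = frechet_derivative (\<lambda>y. h y u v) (at x) w"

lemma bilinear_metric: "x \<in> S \<Longrightarrow> bilinear (h x)"
  and metric_sym: "x \<in> S \<Longrightarrow> h x u v = h x v u"
  using pos_def unfolding positive_definite_def by blast+

lemma Dh_linear:
  assumes "x \<in> S"
  shows "linear (\<lambda>w. Dh x w u v)" "linear (\<lambda>u. Dh x w u v)" "linear (\<lambda>v. Dh x w u v)"
proof -
  show "linear (\<lambda>w. Dh x w u v)"
    unfolding Dh_def using linear_frechet_derivative[OF diff_metric[OF assms]] by simp
  show "linear (\<lambda>u. Dh x w u v)" "linear (\<lambda>v. Dh x w u v)"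
    unfolding Dh_def using bilinear_metric
    by (auto intro!: frechet_derivative_linear_parameter[OF open_S assms] diff_metric assms
        simp: bilinear_def)
qed

lemma Dh_sym:
  assumes "x \<in> S" shows "Dh x w u v = Dh x w v u"
  unfolding Dh_def using assms open_S metric_sym
  by (subst frechet_derivative_cong_open[of S]) auto

definition levi_civita ::
  "complex^'n \<Rightarrow> (complex^'n \<Rightarrow> complex^'n \<Rightarrow> complex^'n) \<Rightarrow> bool" where
  "levi_civita x \<Gamma> \<longleftrightarrow> bilinear \<Gamma> \<and> (\<forall>u v. \<Gamma> u v = \<Gamma> v u) \<and>
     (\<forall>u v w. Dh x w u v = h x (\<Gamma> w u) v + h x u (\<Gamma> w v))"

lemma koszul:
  assumes "x \<in> S" "levi_civita x \<Gamma>"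
  shows "2 * h x (\<Gamma> u v) w = Dh x u v w + Dh x v u w - Dh x w u v"
proof -
  have sym: "\<Gamma> a b = \<Gamma> b a" for a b using assms(2) by (simp add: levi_civita_def)
  have Dh: "Dh x w u v = h x (\<Gamma> w u) v + h x u (\<Gamma> w v)" for u v w
    using assms(2) by (simp add: levi_civita_def)
  show ?thesis
    unfolding Dh using sym[of u v] sym[of u w] sym[of v w]
      metric_sym[OF assms(1), of v] metric_sym[OF assms(1), of u] by simp
qed

text \<open>The Koszul formula, read as a definition through an orthonormal basis, gives existence.\<close>

lemma ex_levi_civita:
  assumes x: "x \<in> S"
  shows "\<exists>\<Gamma>. levi_civita x \<Gamma>"
proof -
  define E where "E = onb (h x)"
  have E: "orthonormal_basis (h x) E"
    unfolding E_def by (rule orthonormal_basis_onb[OF pos_def[OF x]])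
  note bil = bilinear_metric[OF x]
  define k where "k u v w = (Dh x u v w + Dh x v u w - Dh x w u v) / 2" for u v w
  note lins = Dh_linear[OF x, THEN linear_add] Dh_linear[OF x, THEN linear_scale]
  define \<Gamma> where "\<Gamma> u v = (\<Sum>e\<in>E. k u v e *\<^sub>R e)" for u v
  have k_sym: "k u v w = k v u w" for u v w
    using Dh_sym[OF x] by (simp add: k_def)
  have k1: "linear (\<lambda>u. k u v w)" for v w
    by (rule linearI) (simp_all add: k_def lins field_simps)
  have k3: "linear (\<lambda>w. k u v w)" for u v
    by (rule linearI) (simp_all add: k_def lins field_simps)
  have \<Gamma>_k: "h x (\<Gamma> u v) w = k u v w" for u v w
  proof -
    have w: "w = (\<Sum>e\<in>E. h x w e *\<^sub>R e)"
      by (rule orthonormal_basis_expansion[OF E bil])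
    have "h x (\<Gamma> u v) w = (\<Sum>e\<in>E. k u v e * h x w e)"
      unfolding \<Gamma>_def using bil metric_sym[OF x, of w]
      by (subst linear_combination[of "\<lambda>z. h x z w"]) (simp_all add: bilinear_def)
    also have "\<dots> = k u v (\<Sum>e\<in>E. h x w e *\<^sub>R e)"
      by (simp add: linear_combination[OF k3] mult.commute)
    finally show ?thesis using w by simp
  qed
  have "linear (\<lambda>u. \<Gamma> u v)" for v
    unfolding \<Gamma>_def
    by (intro linear_compose_sum ballI linear_compose[OF k1, unfolded o_def])
      (simp add: linear_iff scaleR_add_left)
  moreover have \<Gamma>_sym: "\<Gamma> u v = \<Gamma> v u" for u v by (simp add: \<Gamma>_def k_sym)
  then have "\<Gamma> u = (\<lambda>v. \<Gamma> v u)" for u by blast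
  ultimately have "bilinear \<Gamma>"
    unfolding bilinear_def by metis
  moreover have "Dh x w u v = h x (\<Gamma> w u) v + h x u (\<Gamma> w v)" for u v w
    using Dh_sym[OF x, of w u v] Dh_sym[OF x, of u w v] Dh_sym[OF x, of v w u]
    by (simp add: metric_sym[OF x, of u] \<Gamma>_k k_def field_simps)
  ultimately show ?thesis unfolding levi_civita_def using \<Gamma>_sym by blast
qed

lemma levi_civita_christoffel:
  assumes x: "x \<in> S"
  shows "levi_civita x (christoffel h x)"
proof -
  obtain \<Gamma> where \<Gamma>: "levi_civita x \<Gamma>" using ex_levi_civita[OF x] by blast
  have "\<Gamma>' = \<Gamma>" if "levi_civita x \<Gamma>'" for \<Gamma>'
  proof (intro ext)
    fix u v
    have "h x (\<Gamma>' u v - \<Gamma> u v) w = 0" for w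
      using koszul[OF x that, of u v w] koszul[OF x \<Gamma>, of u v w]
      by (simp add: bilinear_lsub[OF bilinear_metric[OF x]])
    then show "\<Gamma>' u v = \<Gamma> u v"
      using positive_definite_eq_0[OF pos_def[OF x]] by fastforce
  qed
  then have "\<exists>!\<Gamma>. levi_civita x \<Gamma>" using \<Gamma> by blast
  from theI'[OF this] show ?thesis
    unfolding christoffel_def levi_civita_def Dh_def .
qed

lemma
  assumes "x \<in> S"
  shows bilinear_christoffel: "bilinear (christoffel h x)"
    and christoffel_sym: "christoffel h x u v = christoffel h x v u"
    and christoffel_metric:
      "Dh x w u v = h x (christoffel h x w u) v + h x u (christoffel h x w v)"
  using levi_civita_christoffel[OF assms] unfolding levi_civita_def by blast+

section \<open>The derivative of the norm of a form\<close>

text \<open>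
  The frame \<open>(parallel x y) ` E\<close> is parallel at \<open>x\<close> to first order, so its Gram matrix is
  stationary at \<open>x\<close>.
\<close>

definition parallel :: "complex^'n \<Rightarrow> complex^'n \<Rightarrow> complex^'n \<Rightarrow> complex^'n" where
  "parallel x y v = v - christoffel h x (y - x) v"

lemma linear_parallel: "x \<in> S \<Longrightarrow> linear (parallel x y)"
  using bilinear_christoffel[of x] unfolding bilinear_def parallel_def
  by (intro linear_compose_sub linear_ident) blast

lemma parallel_self: "x \<in> S \<Longrightarrow> parallel x x = id"
  by (auto simp: parallel_def bilinear_lzero[OF bilinear_christoffel])

lemma has_derivative_parallel:
  assumes "x \<in> S"
  shows "((\<lambda>y. parallel x y v) has_derivative (\<lambda>w. - christoffel h x w v)) (at x)"
proof -
  have "linear (\<lambda>w. christoffel h x w v)"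
    using bilinear_christoffel[OF assms] by (simp add: bilinear_def)
  then have bl: "bounded_linear (\<lambda>w. christoffel h x w v)"
    by (rule linear_conv_bounded_linear[THEN iffD1])
  show ?thesis
    unfolding parallel_def
    by (rule derivative_eq_intros bounded_linear.has_derivative[OF bl] refl | simp)+
qed

lemma has_derivative_form_parallel:
  fixes \<alpha> :: "complex^'n \<Rightarrow> (complex^'n) list \<Rightarrow> 'b::real_normed_vector"
  assumes "x \<in> S" "\<And>y. y \<in> S \<Longrightarrow> multilinear p (\<alpha> y)"
    and "\<And>vs. length vs = p \<Longrightarrow> (\<lambda>y. \<alpha> y vs) differentiable (at x)" and vs: "length vs = p"
  shows "((\<lambda>y. \<alpha> y (map (parallel x y) vs)) has_derivative
      (\<lambda>w. frechet_derivative (\<lambda>y. \<alpha> y vs) (at x) w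
           - (\<Sum>i<p. \<alpha> x (vs[i := christoffel h x w (vs ! i)])))) (at x)"
proof -
  have "\<alpha> x (vs[i := - christoffel h x w (vs ! i)]) = - \<alpha> x (vs[i := christoffel h x w (vs ! i)])"
    if "i < p" for i w
    using assms(2)[OF assms(1)] that vs linear_neg[of "\<lambda>v. \<alpha> x (vs[i := v])"]
    by (simp add: multilinear_def)
  then show ?thesis
    using has_derivative_multilinear[OF open_S assms(1-3), where F = "parallel x"
        and F' = "\<lambda>w v. - christoffel h x w v", OF _ _ has_derivative_parallel[OF assms(1)] vs]
    by (simp add: parallel_self[OF assms(1)] sum_negf)
qed

lemma gram_parallel_stationary:
  assumes "x \<in> S"
  shows "((\<lambda>y. h y (parallel x y u) (parallel x y v)) has_derivative (\<lambda>_. 0)) (at x)"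
proof -
  have "((\<lambda>y. h y (map (parallel x y) [u, v] ! 0) (map (parallel x y) [u, v] ! 1)) has_derivative
      (\<lambda>w. frechet_derivative (\<lambda>y. h y ([u, v] ! 0) ([u, v] ! 1)) (at x) w
         - (\<Sum>i<2. h x ([u, v][i := christoffel h x w ([u, v] ! i)] ! 0)
                       ([u, v][i := christoffel h x w ([u, v] ! i)] ! 1)))) (at x)"
    by (intro has_derivative_form_parallel)
      (use assms diff_metric bilinear_metric in \<open>simp_all add: multilinear_pair del: One_nat_def\<close>)
  moreover have "{..<2} = {0, 1::nat}" by auto
  ultimately show ?thesis
    using christoffel_metric[OF assms, of _ u v] unfolding Dh_def by simp
qed

text \<open>A quadratic form in \<open>v\<close> is controlled by its finitely many coefficients, hence the uniformity.\<close>

lemma parallel_almost_isometry: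
  assumes x: "x \<in> S" and "\<epsilon> > 0"
  shows "\<forall>\<^sub>F y in nhds x. \<forall>v.
    \<bar>h y (parallel x y v) (parallel x y v) - h x v v\<bar> \<le> \<epsilon> * norm (y - x) * h x v v"
proof -
  define E where "E = onb (h x)"
  have E: "orthonormal_basis (h x) E"
    unfolding E_def by (rule orthonormal_basis_onb[OF pos_def[OF x]])
  then have fin: "finite E" by (simp add: orthonormal_basis_def)
  note bil = bilinear_metric[OF x]
  define n where "n = real (card E)"
  define G where "G y u v = h y (parallel x y u) (parallel x y v)" for y u v
  have G_x: "G x = h x" by (simp add: G_def fun_eq_iff parallel_self[OF x])
  define \<delta> where "\<delta> = \<epsilon> / (n + 1)"
  have "\<delta> > 0" using \<open>\<epsilon> > 0\<close> by (simp add: \<delta>_def n_def)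
  have "\<forall>\<^sub>F y in nhds x. \<bar>G y u v - h x u v\<bar> \<le> \<delta> * norm (y - x)" for u v
  proof -
    have "\<forall>e>0. \<exists>d>0. \<forall>y. norm (y - x) < d \<longrightarrow> norm (G y u v - G x u v - 0) \<le> e * norm (y - x)"
      using gram_parallel_stationary[OF x, of u v] unfolding has_derivative_at_alt G_def by blast
    then show ?thesis
      using \<open>\<delta> > 0\<close> by (auto simp: eventually_nhds_metric dist_norm G_x)
  qed
  then have "\<forall>\<^sub>F y in nhds x. \<forall>u\<in>E. \<forall>v\<in>E. \<bar>G y u v - h x u v\<bar> \<le> \<delta> * norm (y - x)"
    using fin by (simp add: eventually_ball_finite)
  moreover have "\<forall>\<^sub>F y in nhds x. y \<in> S" using open_S x by (rule eventually_nhds_in_open)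
  ultimately show ?thesis
  proof eventually_elim
    case (elim y)
    show ?case
    proof
      fix v
      let ?c = "\<lambda>e. h x v e"
      have bG: "bilinear (\<lambda>u v. G y u v - h x u v)"
      proof -
        have "bilinear (G y)"
          using bilinear_metric[OF elim(2)] linear_compose[OF linear_parallel[OF x, of y]]
          unfolding bilinear_def G_def o_def by blast
        then show ?thesis using bil unfolding bilinear_def by (auto intro: linear_compose_sub)
      qed
      have v: "v = (\<Sum>e\<in>E. ?c e *\<^sub>R e)"
        by (rule orthonormal_basis_expansion[OF E bil])
      have "G y v v - h x v v
        = (\<lambda>u v. G y u v - h x u v) (\<Sum>e\<in>E. ?c e *\<^sub>R e) (\<Sum>e\<in>E. ?c e *\<^sub>R e)"
        using v by simp
      also have "\<dots> = (\<Sum>(e, f)\<in>E \<times> E. ?c e * (?c f * (G y e f - h x e f)))"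
        by (subst bilinear_sum[OF bG])
          (simp add: bilinear_lmul[OF bG, simplified] bilinear_rmul[OF bG, simplified]
            mult.left_commute)
      finally have "\<bar>G y v v - h x v v\<bar>
          \<le> (\<Sum>(e, f)\<in>E \<times> E. \<bar>?c e * (?c f * (G y e f - h x e f))\<bar>)"
        using sum_abs[of "\<lambda>(e, f). ?c e * (?c f * (G y e f - h x e f))" "E \<times> E"]
        by (simp add: case_prod_unfold)
      also have "\<dots> \<le> (\<Sum>(e, f)\<in>E \<times> E. \<delta> * norm (y - x) * (\<bar>?c e\<bar> * \<bar>?c f\<bar>))"
      proof (intro sum_mono, clarify)
        fix e f assume "e \<in> E" "f \<in> E"
        then have "\<bar>G y e f - h x e f\<bar> * (\<bar>?c e\<bar> * \<bar>?c f\<bar>) \<le> \<delta> * norm (y - x) * (\<bar>?c e\<bar> * \<bar>?c f\<bar>)"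
          using elim(1) by (intro mult_right_mono) auto
        then show "\<bar>?c e * (?c f * (G y e f - h x e f))\<bar> \<le> \<delta> * norm (y - x) * (\<bar>?c e\<bar> * \<bar>?c f\<bar>)"
          by (simp add: abs_mult mult_ac)
      qed
      also have "\<dots> = \<delta> * norm (y - x) * (\<Sum>e\<in>E. 1 * \<bar>?c e\<bar>)\<^sup>2"
        by (simp add: sum.cartesian_product[symmetric] power2_eq_square sum_product
            flip: sum_distrib_left)
      also have "\<dots> \<le> \<delta> * norm (y - x) * ((\<Sum>e\<in>E. 1\<^sup>2) * (\<Sum>e\<in>E. \<bar>?c e\<bar>\<^sup>2))"
        using \<open>\<delta> > 0\<close> by (intro mult_left_mono Cauchy_Schwarz_ineq_sum) auto
      also have "\<dots> = \<delta> * n * norm (y - x) * h x v v"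
        by (simp add: n_def orthonormal_basis_parseval[OF E bil, of v])
      also have "\<dots> \<le> \<epsilon> * norm (y - x) * h x v v"
        using \<open>\<epsilon> > 0\<close> orthonormal_basis_parseval[OF E bil, of v]
        by (intro mult_right_mono) (auto simp: \<delta>_def n_def field_simps intro: sum_nonneg)
      finally show "\<bar>h y (parallel x y v) (parallel x y v) - h x v v\<bar> \<le> \<epsilon> * norm (y - x) * h x v v"
        by (simp add: G_def)
    qed
  qed
qed

text \<open>
  The bases \<open>onb (h y)\<close> may jump as \<open>y\<close> varies, so the sum cannot be differentiated termwise. The
  frame that is parallel at \<open>x\<close> gives a differentiable substitute \<open>P\<close>: it differs from the sum by
  \<open>o(norm (y - x))\<close>, and by the product rule its terms have the covariant derivative as derivative.
\<close>

lemma has_derivative_sum_norm_sq: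
  fixes \<alpha> :: "complex^'n \<Rightarrow> 'n cform"
  assumes x: "x \<in> S" and multi: "\<And>y. y \<in> S \<Longrightarrow> multilinear p (\<alpha> y)"
    and diff: "\<And>vs. length vs = p \<Longrightarrow> (\<lambda>y. \<alpha> y vs) differentiable (at x)"
  shows "((\<lambda>y. \<Sum>vs\<in>tuples (onb (h y)) p. (cmod (\<alpha> y vs))\<^sup>2) has_derivative
      (\<lambda>w. 2 * (\<Sum>vs\<in>tuples (onb (h x)) p. \<alpha> x vs \<bullet> cov_deriv h \<alpha> x w vs))) (at x)"
proof -
  define N where "N y = (\<Sum>vs\<in>tuples (onb (h y)) p. (cmod (\<alpha> y vs))\<^sup>2)" for y
  define P where "P y = (\<Sum>vs\<in>tuples (onb (h x)) p. (cmod (\<alpha> y (map (parallel x y) vs)))\<^sup>2)" for y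
  define P' where "P' w = 2 * (\<Sum>vs\<in>tuples (onb (h x)) p. \<alpha> x vs \<bullet> cov_deriv h \<alpha> x w vs)" for w
  have deriv: "((\<lambda>y. \<alpha> y (map (parallel x y) vs)) has_derivative (\<lambda>w. cov_deriv h \<alpha> x w vs)) (at x)"
    if "vs \<in> tuples (onb (h x)) p" for vs
    using has_derivative_form_parallel[OF x multi diff, of vs] that by (simp add: cov_deriv_def)
  have "(P has_derivative (\<lambda>w. \<Sum>vs\<in>tuples (onb (h x)) p.
      \<alpha> x (map (parallel x x) vs) \<bullet> cov_deriv h \<alpha> x w vs
      + cov_deriv h \<alpha> x w vs \<bullet> \<alpha> x (map (parallel x x) vs))) (at x)"
    unfolding P_def power2_norm_eq_inner
    by (intro has_derivative_sum has_derivative_inner deriv)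
  then have P': "(P has_derivative P') (at x)"
    by (simp add: P'_def[abs_def] parallel_self[OF x] inner_commute sum_distrib_left flip: mult_2)
  have P_nonneg: "P y \<ge> 0" for y by (auto simp: P_def intro: sum_nonneg)
  have "((\<lambda>y. N y - P y) has_derivative (\<lambda>_. 0)) (at x)"
  proof (rule has_derivative_zeroI)
    fix e :: real assume "e > 0"
    define B where "B = P x + 1"
    have "B > 0" using P_nonneg[of x] by (simp add: B_def)
    define \<epsilon> where "\<epsilon> = e / (2 * (real p + 1) * B)"
    have "\<epsilon> > 0" using \<open>e > 0\<close> \<open>B > 0\<close> by (simp add: \<epsilon>_def)
    have "isCont P x" by (rule has_derivative_continuous[OF P'])
    then have "\<forall>\<^sub>F y in nhds x. P y < B"
      unfolding isCont_def tendsto_at_iff_tendsto_nhds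
      by (rule order_tendstoD(2)) (simp add: B_def)
    moreover have "\<forall>\<^sub>F y in nhds x. norm (y - x) < 1 / (2 * (real p + 1) * \<epsilon>)"
      using \<open>\<epsilon> > 0\<close> unfolding eventually_nhds_metric dist_norm
      by (intro exI[of _ "1 / (2 * (real p + 1) * \<epsilon>)"]) simp
    moreover have "\<forall>\<^sub>F y in nhds x. y \<in> S" using open_S x by (rule eventually_nhds_in_open)
    ultimately show "\<forall>\<^sub>F y in nhds x. norm ((N y - P y) - (N x - P x)) \<le> e * norm (y - x)"
      using parallel_almost_isometry[OF x \<open>\<epsilon> > 0\<close>]
    proof eventually_elim
      case (elim y)
      define t where "t = \<epsilon> * norm (y - x)"
      have "norm (y - x) * (2 * (real p + 1) * \<epsilon>) < 1"
        using elim(2) \<open>\<epsilon> > 0\<close> by (subst (asm) pos_less_divide_eq) auto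
      then have "real p * t + t \<le> 1 / 2" by (simp add: t_def algebra_simps)
      moreover have "t \<ge> 0" "real p * t \<ge> 0" using \<open>\<epsilon> > 0\<close> by (simp_all add: t_def)
      ultimately have t: "0 \<le> t" "t < 1" "real p * t \<le> 1 / 2" by linarith+
      \<comment> \<open>Raising the relative error \<open>t\<close> of the Gram matrix to the power \<open>p\<close> costs a factor \<open>p\<close>.\<close>
      have bern: "1 - real p * t \<le> (1 - t) ^ p"
        using Bernoulli_inequality[of "- t" p] t by simp
      note approx = form_norm_almost_orthonormal[OF orthonormal_basis_onb[OF pos_def[OF elim(3)]]
          bilinear_metric[OF elim(3)] orthonormal_basis_onb[OF pos_def[OF x]] pos_def[OF x]
          linear_parallel[OF x] multi[OF elim(3)] t(1,2) elim(4)[folded t_def, rule_format]]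
      have N_nonneg: "N y \<ge> 0" by (auto simp: N_def intro: sum_nonneg)
      have "(1 - real p * t) * N y \<le> P y"
        using mult_right_mono[OF bern N_nonneg] approx(1) by (simp add: N_def P_def)
      moreover have "(1 - real p * t) * P y \<le> N y"
        using mult_right_mono[OF bern P_nonneg[of y]] approx(2) by (simp add: N_def P_def)
      moreover have "(1 / 2) * N y \<le> (1 - real p * t) * N y"
        using t N_nonneg by (intro mult_right_mono) auto
      ultimately have "N y \<le> 2 * P y" "N y - P y \<le> real p * t * N y" "P y - N y \<le> real p * t * P y"
        by (auto simp: algebra_simps)
      moreover have "real p * t * N y \<le> real p * t * (2 * P y)"
        using t calculation(1) by (intro mult_left_mono) auto
      moreover have "real p * t * P y \<le> real p * t * (2 * P y)"
        using t P_nonneg[of y] by (intro mult_left_mono) auto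
      ultimately have "\<bar>N y - P y\<bar> \<le> real p * t * (2 * P y)" by linarith
      also have "\<dots> \<le> (real p + 1) * t * (2 * B)"
        using t elim(1) P_nonneg[of y] by (intro mult_mono) auto
      also have "\<dots> = e * norm (y - x)"
      proof -
        have "2 * (real p + 1) * B * \<epsilon> = e"
          using \<open>B > 0\<close> by (simp add: \<epsilon>_def add_nonneg_eq_0_iff)
        moreover have "(real p + 1) * t * (2 * B) = 2 * (real p + 1) * B * \<epsilon> * norm (y - x)"
          by (simp add: t_def mult_ac)
        ultimately show ?thesis by simp
      qed
      moreover have "N x = P x" by (simp add: N_def P_def parallel_self[OF x])
      ultimately show ?case by simp
    qed
  qed
  from has_derivative_add[OF this P'] have "(N has_derivative P') (at x)" by simp
  then show ?thesis unfolding N_def P'_def .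
qed

end

section \<open>Kaehler metrics and holomorphic forms\<close>

lemma linear_ii: "linear (\<lambda>v :: complex^'n. \<i> *s v)"
  by (rule linearI) (simp_all add: vec_eq_iff algebra_simps)

lemma ii_ii: "\<i> *s (\<i> *s v) = - (v :: complex^'n)"
  by (simp add: vec_eq_iff)

locale chart_kaehler = chart_metric S h
  for S :: "(complex^'n::finite) set" and h +
  assumes hermitian: "x \<in> S \<Longrightarrow> h x (\<i> *s u) (\<i> *s v) = h x u v"
    and closed: "x \<in> S \<Longrightarrow> length vs = 3 \<Longrightarrow> ext_deriv (\<lambda>y. fundamental_form (h y)) x vs = 0"
begin

lemma closed_Dh:
  assumes "x \<in> S"
  shows "Dh x a (\<i> *s b) c - Dh x b (\<i> *s a) c + Dh x c (\<i> *s a) b = 0"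
  using closed[OF assms, of "[a, b, c]"]
  by (simp add: ext_deriv_def fundamental_form_def Dh_def del_nth_def eval_nat_numeral)

lemma Dh_hermitian:
  assumes "x \<in> S"
  shows "Dh x w (\<i> *s u) (\<i> *s v) = Dh x w u v"
  unfolding Dh_def using assms open_S hermitian
  by (subst frechet_derivative_cong_open[of S]) auto

text \<open>
  This is \<open>\<nabla>J = 0\<close>. By the Koszul formula, \<open>2 h ((\<nabla>\<^bsub>u\<^esub> J) v) w\<close> is a combination of values of the
  exterior derivative of the fundamental form, namely at \<open>(Jv, Ju, w)\<close> and at \<open>(v, Ju, Jw)\<close>.
\<close>

lemma christoffel_ii:
  assumes x: "x \<in> S"
  shows "christoffel h x u (\<i> *s v) = \<i> *s christoffel h x u v"
proof -
  note neg = linear_neg[OF Dh_linear(2)[OF x]] linear_neg[OF Dh_linear(3)[OF x]]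
  have skew: "Dh x w (\<i> *s a) b = - Dh x w a (\<i> *s b)" for w a b
    using Dh_hermitian[OF x, of w "\<i> *s a" b] by (simp add: ii_ii neg)
  have h_skew: "h x (\<i> *s a) b = - h x a (\<i> *s b)" for a b
    using hermitian[OF x, of "\<i> *s a" b] by (simp add: ii_ii bilinear_lneg[OF bilinear_metric[OF x]])
  have "h x (christoffel h x u (\<i> *s v) - \<i> *s christoffel h x u v) w = 0" for w
  proof -
    have "2 * (h x (christoffel h x u (\<i> *s v)) w + h x (christoffel h x u v) (\<i> *s w)) = 0"
      using koszul[OF x levi_civita_christoffel[OF x], of u "\<i> *s v" w]
        koszul[OF x levi_civita_christoffel[OF x], of u v "\<i> *s w"]
        closed_Dh[OF x, of "\<i> *s v" "\<i> *s u" w] closed_Dh[OF x, of v "\<i> *s u" "\<i> *s w"]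
        Dh_sym[OF x, of w u "\<i> *s v"] Dh_sym[OF x, of "\<i> *s w" u v] skew[of w v u] skew[of u v w]
      by (simp add: ii_ii neg Dh_hermitian[OF x] algebra_simps)
    then show ?thesis
      by (simp add: bilinear_lsub[OF bilinear_metric[OF x]] h_skew)
  qed
  then show ?thesis using positive_definite_eq_0[OF pos_def[OF x]] by fastforce
qed

end

lemma type_p0_ii:
  assumes "type_p0 p \<alpha>" "i < p" "length vs = p"
  shows "\<alpha> (vs[i := \<i> *s v]) = \<i> * \<alpha> (vs[i := v])"
proof -
  have "\<alpha> (vs[i := v]) + \<i> * \<alpha> (vs[i := \<i> *s v]) = 0"
    using assms unfolding type_p0_def by blast
  then have "\<i> * (\<alpha> (vs[i := v]) + \<i> * \<alpha> (vs[i := \<i> *s v])) = 0" by simp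
  then show ?thesis by (simp add: distrib_left flip: mult.assoc)
qed

text \<open>
  The first summand of \<open>\<partial>bar \<alpha>\<close> at \<open>u # vs\<close> is conjugate linear in \<open>u\<close>, the others are complex linear
  because \<open>\<alpha>\<close> is. So they vanish separately: the components of \<open>\<alpha>\<close> satisfy the Cauchy-Riemann equations.
\<close>

lemma dbar_fun_component_eq_0:
  fixes \<alpha> :: "complex^'n::finite \<Rightarrow> 'n cform"
  assumes S: "open S" "x \<in> S" and type: "\<And>y. y \<in> S \<Longrightarrow> type_p0 p (\<alpha> y)"
    and diff: "\<And>vs. length vs = p \<Longrightarrow> (\<lambda>y. \<alpha> y vs) differentiable (at x)"
    and dbar: "\<And>vs. length vs = Suc p \<Longrightarrow> dbar \<alpha> x vs = 0"
    and vs: "length vs = p"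
  shows "dbar_fun (\<lambda>y. \<alpha> y vs) x u = 0"
proof -
  define R where "R u = (\<Sum>i<p. (-1) ^ Suc i * dbar_fun (\<lambda>y. \<alpha> y (u # del_nth i vs)) x (vs ! i))" for u
  have split: "dbar_fun (\<lambda>y. \<alpha> y vs) x u + R u = 0" for u
    using dbar[of "u # vs"] vs
    by (simp add: dbar_def R_def sum.lessThan_Suc_shift del_nth_def del: sum.lessThan_Suc)
  have R_ii: "R (\<i> *s u) = \<i> * R u"
  proof -
    have "dbar_fun (\<lambda>y. \<alpha> y ((\<i> *s u) # del_nth i vs)) x v
        = \<i> * dbar_fun (\<lambda>y. \<alpha> y (u # del_nth i vs)) x v" if "i < p" for i v
    proof -
      let ?us = "u # del_nth i vs"
      have len: "length ?us = p" using that vs by (simp add: del_nth_def)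
      have "\<alpha> y ((\<i> *s u) # del_nth i vs) = \<i> * \<alpha> y ?us" if "y \<in> S" for y
        using type_p0_ii[OF type[OF that] _ len, of 0 u] \<open>i < p\<close> by simp
      then have "frechet_derivative (\<lambda>y. \<alpha> y ((\<i> *s u) # del_nth i vs)) (at x)
          = frechet_derivative (\<lambda>y. \<i> * \<alpha> y ?us) (at x)"
        by (rule frechet_derivative_cong_open[OF S])
      also have "\<dots> = (\<lambda>w. \<i> * frechet_derivative (\<lambda>y. \<alpha> y ?us) (at x) w)"
        using diff[OF len] frechet_derivative_works
        by (intro frechet_derivative_at[symmetric] has_derivative_mult_right) blast
      finally show ?thesis by (simp add: dbar_fun_def algebra_simps)
    qed
    then show ?thesis unfolding R_def sum_distrib_left by (intro sum.cong) auto
  qed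
  have "linear (frechet_derivative (\<lambda>y. \<alpha> y vs) (at x))"
    by (rule linear_frechet_derivative[OF diff[OF vs]])
  then have "\<i> * dbar_fun (\<lambda>y. \<alpha> y vs) x (\<i> *s u) = dbar_fun (\<lambda>y. \<alpha> y vs) x u"
    by (simp add: dbar_fun_def ii_ii linear_neg algebra_simps)
  moreover have "\<i> * (dbar_fun (\<lambda>y. \<alpha> y vs) x (\<i> *s u) + \<i> * R u) = 0"
    using split[of "\<i> *s u"] by (simp add: R_ii)
  ultimately have "dbar_fun (\<lambda>y. \<alpha> y vs) x u = R u"
    by (simp add: distrib_left flip: mult.assoc)
  then show ?thesis using split[of u] by simp
qed

context chart_kaehler
begin

lemma cov_deriv_ii:
  fixes \<alpha> :: "complex^'n \<Rightarrow> 'n cform"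
  assumes x: "x \<in> S" and type: "\<And>y. y \<in> S \<Longrightarrow> type_p0 p (\<alpha> y)"
    and diff: "\<And>vs. length vs = p \<Longrightarrow> (\<lambda>y. \<alpha> y vs) differentiable (at x)"
    and dbar: "\<And>vs. length vs = Suc p \<Longrightarrow> dbar \<alpha> x vs = 0"
    and vs: "length vs = p"
  shows "cov_deriv h \<alpha> x (\<i> *s u) vs = \<i> * cov_deriv h \<alpha> x u vs"
proof -
  let ?D = "frechet_derivative (\<lambda>y. \<alpha> y vs) (at x)"
  have "?D u + \<i> * ?D (\<i> *s u) = 0"
    using dbar_fun_component_eq_0[OF open_S x type diff dbar vs, of u] by (simp add: dbar_fun_def)
  then have "\<i> * (?D u + \<i> * ?D (\<i> *s u)) = 0" by simp
  then have "?D (\<i> *s u) = \<i> * ?D u" by (simp add: distrib_left flip: mult.assoc)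
  moreover have "christoffel h x (\<i> *s u) v = \<i> *s christoffel h x u v" for v
    using christoffel_ii[OF x, of v u] christoffel_sym[OF x] by metis
  then have "\<alpha> x (vs[i := christoffel h x (\<i> *s u) v]) = \<i> * \<alpha> x (vs[i := christoffel h x u v])"
    if "i < p" for i v
    using type_p0_ii[OF type[OF x] that vs] by simp
  ultimately show ?thesis
    using vs by (simp add: cov_deriv_def right_diff_distrib sum_distrib_left)
qed

lemma refined_kato_in_chart:
  fixes \<alpha> :: "complex^'n \<Rightarrow> 'n cform"
  assumes x: "x \<in> S" and multi: "\<And>y. y \<in> S \<Longrightarrow> multilinear p (\<alpha> y)"
    and type: "\<And>y. y \<in> S \<Longrightarrow> type_p0 p (\<alpha> y)"
    and diff: "\<And>vs. length vs = p \<Longrightarrow> (\<lambda>y. \<alpha> y vs) differentiable (at x)"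
    and dbar: "\<And>vs. length vs = Suc p \<Longrightarrow> dbar \<alpha> x vs = 0"
    and nz: "length us = p" "\<alpha> x us \<noteq> 0"
  shows "covector_norm (h x) (frechet_derivative (\<lambda>y. form_norm (h y) p (\<alpha> y)) (at x))
    \<le> 1 / sqrt 2 * form_valued_norm (h x) p (cov_deriv h \<alpha> x)"
proof -
  define E where "E = onb (h x)"
  have E: "orthonormal_basis (h x) E"
    unfolding E_def by (rule orthonormal_basis_onb[OF pos_def[OF x]])
  then have fin: "finite E" and spanE: "span E = UNIV" by (simp_all add: orthonormal_basis_def)
  have finT: "finite (tuples E p)" using finite_lists_length_eq[OF fin] .
  note bil = bilinear_metric[OF x]
  define N where "N = (\<Sum>vs\<in>tuples E p. (cmod (\<alpha> x vs))\<^sup>2)"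
  define f where "f = sqrt (N / fact p)"
  have "\<exists>vs\<in>tuples E p. \<alpha> x vs \<noteq> 0"
    using multilinear_eq_0[OF multi[OF x] spanE _ nz(1)] nz(2) by blast
  then have "N > 0"
    unfolding N_def using finT by (metis (mono_tags, lifting) norm_eq_zero sum_pos2 zero_le_power2 zero_less_power2)
  then have "f > 0" "f\<^sup>2 = N / fact p" by (simp_all add: f_def)
  define l where "l w = (\<Sum>vs\<in>tuples E p. \<alpha> x vs \<bullet> cov_deriv h \<alpha> x w vs) / (fact p * f)" for w
  have deriv: "((\<lambda>y. form_norm (h y) p (\<alpha> y)) has_derivative l) (at x)"
  proof -
    have "((\<lambda>y. (\<Sum>vs\<in>tuples (onb (h y)) p. (cmod (\<alpha> y vs))\<^sup>2) / fact p) has_derivative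
        (\<lambda>w. (2 * (\<Sum>vs\<in>tuples E p. \<alpha> x vs \<bullet> cov_deriv h \<alpha> x w vs)) / fact p)) (at x)"
      using bounded_linear.has_derivative[OF bounded_linear_divide
          has_derivative_sum_norm_sq[OF x multi diff], of "fact p"] unfolding E_def .
    from has_derivative_real_sqrt[OF _ this] \<open>N > 0\<close>
    have "((\<lambda>y. sqrt ((\<Sum>vs\<in>tuples (onb (h y)) p. (cmod (\<alpha> y vs))\<^sup>2) / fact p)) has_derivative
        (\<lambda>w. (2 * (\<Sum>vs\<in>tuples E p. \<alpha> x vs \<bullet> cov_deriv h \<alpha> x w vs)) / fact p * (inverse f / 2))) (at x)"
      by (simp add: f_def N_def E_def)
    then show ?thesis
      unfolding form_norm_def l_def by (simp add: field_simps)
  qed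
  then have "linear l" by (rule has_derivative_linear)
  \<comment> \<open>\<open>A\<close> below is the Hermitian product of the covariant derivative with \<open>\<alpha>\<close>; replacing \<open>w\<close> by
    \<open>\<i> *s w\<close> multiplies it by \<open>\<i>\<close> and so turns its real part into minus its imaginary part.\<close>
  have key: "(l w)\<^sup>2 + (l (\<i> *s w))\<^sup>2 \<le> (form_norm (h x) p (cov_deriv h \<alpha> x w))\<^sup>2" for w
  proof -
    define A where "A = (\<Sum>vs\<in>tuples E p. cnj (\<alpha> x vs) * cov_deriv h \<alpha> x w vs)"
    define Q where "Q = (\<Sum>vs\<in>tuples E p. (cmod (cov_deriv h \<alpha> x w vs))\<^sup>2)"
    have l1: "l w = Re A / (fact p * f)"
      by (simp add: l_def A_def inner_complex_def)
    have "(\<Sum>vs\<in>tuples E p. \<alpha> x vs \<bullet> cov_deriv h \<alpha> x (\<i> *s w) vs) = - Im A"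
      unfolding A_def Im_sum sum_negf[symmetric]
      using cov_deriv_ii[OF x type diff dbar] by (intro sum.cong) (auto simp: inner_complex_def)
    then have l2: "l (\<i> *s w) = - Im A / (fact p * f)" by (simp add: l_def)
    have "cmod A \<le> (\<Sum>vs\<in>tuples E p. cmod (\<alpha> x vs) * cmod (cov_deriv h \<alpha> x w vs))"
      unfolding A_def by (rule order_trans[OF norm_sum]) (simp add: norm_mult)
    then have "(cmod A)\<^sup>2 \<le> (\<Sum>vs\<in>tuples E p. cmod (\<alpha> x vs) * cmod (cov_deriv h \<alpha> x w vs))\<^sup>2"
      by (rule power_mono) simp
    also have "\<dots> \<le> N * Q" unfolding N_def Q_def by (rule Cauchy_Schwarz_ineq_sum)
    finally have A: "(cmod A)\<^sup>2 \<le> N * Q" .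
    have "(l w)\<^sup>2 + (l (\<i> *s w))\<^sup>2 = (cmod A)\<^sup>2 / (fact p * f)\<^sup>2"
      by (simp add: l1 l2 cmod_power2 power_divide add_divide_distrib)
    also have "\<dots> \<le> (N * Q) / (fact p * f)\<^sup>2"
      using A by (rule divide_right_mono) simp
    also have "(fact p * f)\<^sup>2 = fact p * N"
      unfolding power_mult_distrib \<open>f\<^sup>2 = N / fact p\<close> by (simp add: power2_eq_square)
    also have "N * Q / (fact p * N) = Q / fact p" using \<open>N > 0\<close> by simp
    also have "\<dots> = (form_norm (h x) p (cov_deriv h \<alpha> x w))\<^sup>2"
      unfolding form_norm_def Q_def E_def by (simp add: sum_nonneg)
    finally show ?thesis .
  qed
  \<comment> \<open>The norm of \<open>l\<close> may equally be computed in the orthonormal basis \<open>\<i> *s E\<close>.\<close>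
  have "(\<Sum>e\<in>E. (l e)\<^sup>2) \<le> 1 * (\<Sum>e\<in>(\<lambda>v. \<i> *s v) ` E. (l e)\<^sup>2)"
  proof (rule covector_norm_mono[OF E bil _ bil])
    have "v \<in> span ((\<lambda>v. \<i> *s v) ` E)" for v
    proof -
      have "v = \<i> *s (\<i> *s (- v))" by (simp add: ii_ii)
      then show ?thesis using linear_span_image[OF linear_ii, of E] spanE by blast
    qed
    then show "orthonormal_basis (h x) ((\<lambda>v. \<i> *s v) ` E)"
      using E by (auto simp: orthonormal_basis_def hermitian[OF x])
  qed (use \<open>linear l\<close> in auto)
  also have "\<dots> = (\<Sum>e\<in>E. (l (\<i> *s e))\<^sup>2)"
    by (simp add: sum.reindex inj_on_def)
  finally have "2 * (\<Sum>e\<in>E. (l e)\<^sup>2) \<le> (\<Sum>e\<in>E. (l e)\<^sup>2 + (l (\<i> *s e))\<^sup>2)"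
    by (simp add: sum.distrib)
  also have "\<dots> \<le> (\<Sum>e\<in>E. (form_norm (h x) p (cov_deriv h \<alpha> x e))\<^sup>2)"
    by (intro sum_mono key)
  finally have "sqrt (\<Sum>e\<in>E. (l e)\<^sup>2) \<le> sqrt ((\<Sum>e\<in>E. (form_norm (h x) p (cov_deriv h \<alpha> x e))\<^sup>2) / 2)"
    by (intro real_sqrt_le_mono) simp
  then show ?thesis
    unfolding covector_norm_def form_valued_norm_def frechet_derivative_at[OF deriv, symmetric]
    by (simp add: E_def real_sqrt_divide)
qed

end

lemma smooth_on_imp_differentiable:
  "smooth_on S f \<Longrightarrow> x \<in> S \<Longrightarrow> f differentiable (at x)"
  unfolding smooth_on_def by (metis diff_upto.simps(2))

lemma (in kaehler_manifold) chart_kaehler: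
  assumes "c \<in> \<A>"
  shows "chart_kaehler (cimg c) (g c)"
proof
  show "open (cimg c)" using chart_open[OF assms] by simp
  show "positive_definite (g c x)" if "x \<in> cimg c" for x
    using metric_tensor assms that unfolding metric_tensor_on_def positive_definite_def by blast
  show "(\<lambda>y. g c y u v) differentiable (at x)" if "x \<in> cimg c" for x u v
    using metric_tensor assms that
    by (intro smooth_on_imp_differentiable[of "cimg c"]) (simp_all add: metric_tensor_on_def)
qed (use assms in \<open>auto intro: metric_hermitian fundamental_form_closed\<close>)

theorem corollary4p3:
  fixes M :: "'a topology"
    and \<A> :: "('a, 'n::finite) chart set"
    and g :: "('a, 'n) chart \<Rightarrow> complex^'n \<Rightarrow> 'n metric"
    and \<omega> :: "('a, 'n) chart \<Rightarrow> complex^'n \<Rightarrow> 'n cform"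
    and p :: nat and m :: 'a and c :: "('a, 'n) chart"
  assumes "kaehler_manifold M \<A> g"
    and "holomorphic_form_on \<A> p \<omega>"
    and "m \<in> topspace M"
    and "c \<in> \<A>" and "m \<in> cdom c"
    and "\<exists>vs. length vs = p \<and> \<omega> c (cmap c m) vs \<noteq> 0"
  shows "covector_norm (g c (cmap c m))
           (frechet_derivative (\<lambda>x. form_norm (g c x) p (\<omega> c x)) (at (cmap c m)))
         \<le> 1 / sqrt 2 * form_valued_norm (g c (cmap c m)) p (cov_deriv (g c) (\<omega> c) (cmap c m))"
proof -
  interpret chart_kaehler "cimg c" "g c"
    by (rule kaehler_manifold.chart_kaehler) fact+
  have x: "cmap c m \<in> cimg c" using \<open>m \<in> cdom c\<close> by simp
  have \<omega>: "alternating_form p (\<omega> c y)" "type_p0 p (\<omega> c y)"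
      "length vs = p \<Longrightarrow> smooth_on (cimg c) (\<lambda>x. \<omega> c x vs)"
      "length ws = Suc p \<Longrightarrow> dbar (\<omega> c) y ws = 0" if "y \<in> cimg c" for y vs ws
    using assms(2) \<open>c \<in> \<A>\<close> that unfolding holomorphic_form_on_def smooth_form_on_def by blast+
  obtain us where us: "length us = p" "\<omega> c (cmap c m) us \<noteq> 0" using assms(6) by blast
  show ?thesis
  proof (rule refined_kato_in_chart[where \<alpha> = "\<omega> c" and us = us])
    show "multilinear p (\<omega> c y)" if "y \<in> cimg c" for y
      using \<omega>(1)[OF that] by (rule alternating_form_imp_multilinear)
    show "(\<lambda>y. \<omega> c y vs) differentiable at (cmap c m)" if "length vs = p" for vs
      using \<omega>(3)[OF x that] x by (rule smooth_on_imp_differentiable)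
  qed (use \<omega> x us in auto)
qed

end
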